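(* Any finite subdirect product of $P$-symmetric rings is $P$-symmetric.
   Context: Rings are associative with identity (not necessarily commutative). $P(R)$ denotes the prime radical of a ring $R$ (the intersection of all prime two-sided ideals of $R$). A ring $R$ is $P$-symmetric if for any $a,b,c\in R$, $abc=0$ implies $bac\in P(R)$. A ring $R$ is a (finite) subdirect product of rings $A_1,\dots,A_n$ if there are surjective ring homomorphisms $f_i:R\to A_i$ $(1\le i\le n)$ with $\bigcap_{i=1}^n \ker f_i=0$. *)

theory Defs
  imports "HOL-Algebra.Algebra"
begin

(* The library's primeideal is element-wise and extends cring, so it is not usable
   for noncommutative rings; this is the usual two-sided notion via products of ideals. *)
locale two_sided_primeideal = ideal P R for P and R (structure) +
  assumes P_notcarr: "carrier R \<noteq> P"
    and P_prime:
      "\<lbrakk>ideal I R; ideal J R; I \<cdot>\<^bsub>R\<^esub> J \<subseteq> P\<rbrakk> \<Longrightarrow> I \<subseteq> P \<or> J \<subseteq> P"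

(* Intersecting with the carrier only matters when there are no prime ideals (the zero
   ring): the empty intersection is then the whole ring. *)
definition prime_radical :: "('a, 'm) ring_scheme \<Rightarrow> 'a set"
  where "prime_radical R = carrier R \<inter> \<Inter>{P. two_sided_primeideal P R}"

locale P_symmetric_ring = ring R for R (structure) +
  assumes P_symmetric:
    "\<lbrakk>a \<in> carrier R; b \<in> carrier R; c \<in> carrier R; a \<otimes> b \<otimes> c = \<zero>\<rbrakk>
      \<Longrightarrow> b \<otimes> a \<otimes> c \<in> prime_radical R"

(* R is a subdirect product of A 1, ..., A n.  That the factors share the element type 'b
   is no restriction, since finitely many types embed into a common sum type.
   For n = 0 the intersection of kernels is the whole ring, so R is a zero ring. *)
definition subdirect_product ::
    "('a, 'm) ring_scheme \<Rightarrow> nat \<Rightarrow> (nat \<Rightarrow> ('b, 'n) ring_scheme) \<Rightarrow> bool"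
  where "subdirect_product R n A \<longleftrightarrow>
    ring R \<and> (\<forall>i\<in>{1..n}. ring (A i)) \<and>
    (\<exists>f. (\<forall>i\<in>{1..n}. f i \<in> ring_hom R (A i) \<and> f i ` carrier R = carrier (A i)) \<and>
         carrier R \<inter> (\<Inter>i\<in>{1..n}. a_kernel R (A i) (f i)) = {\<zero>\<^bsub>R\<^esub>})"

end

theory Submission
  imports Defs
begin

text \<open>
  Let \<open>K\<^sub>1, \<dots>, K\<^sub>n\<close> be the kernels of the projections \<open>f\<^sub>i : R \<rightarrow> A\<^sub>i\<close>. Their intersection is zero, so
  every prime ideal \<open>P\<close> of \<open>R\<close> contains some \<open>K\<^sub>i\<close>, and then \<open>f\<^sub>i P\<close> is a prime ideal of \<open>A\<^sub>i\<close> whose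
  preimage is \<open>P\<close>. If \<open>abc = 0\<close>, then \<open>f\<^sub>i (bac)\<close> lies in the prime radical of \<open>A\<^sub>i\<close>, hence in
  \<open>f\<^sub>i P\<close>, and therefore \<open>bac\<close> lies in \<open>P\<close>.
\<close>

text \<open>Induction on \<open>S\<close>: the product of \<open>K j\<close> with the intersection
  of the remaining ideals lies in both factors, hence in \<open>P\<close>, and primeness selects one
  of the two.\<close>

lemma (in two_sided_primeideal) finite_Inter_subset_imp:
  assumes "finite S" and "\<And>i. i \<in> S \<Longrightarrow> ideal (K i) R"
    and "carrier R \<inter> (\<Inter>i\<in>S. K i) \<subseteq> P"
  shows "\<exists>i\<in>S. K i \<subseteq> P"
  using assms
proof (induction S rule: finite_induct)
  case empty
  \<comment> \<open>The intersection over no ideals is all of \<open>carrier R\<close>, which a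
    proper ideal cannot contain.\<close>
  then show ?case
    using P_notcarr a_subset by auto
next
  case (insert j S)
  let ?J = "carrier R \<inter> (\<Inter>i\<in>S. K i)"
  have K: "ideal (K j) R" and J: "ideal ?J R"
    \<comment> \<open>Adding \<open>carrier R\<close> to the family keeps it nonempty when
      \<open>S\<close> is empty.\<close>
    using insert.prems(1) oneideal i_Intersect[of "insert (carrier R) (K ` S)"] by auto
  have "K j \<cdot> ?J \<subseteq> K j \<inter> ?J"
    by (rule ideal_prod_inter[OF K J])
  also have "\<dots> \<subseteq> P"
    using insert.prems(2) by auto
  finally show ?case
    using P_prime[OF K J] insert.IH insert.prems(1) by auto
qed

text \<open>If \<open>h x = h y\<close> with \<open>y\<close> in \<open>I\<close>, then
  \<open>x\<close> and \<open>y\<close> differ by an element of the kernel, hence of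
  \<open>I\<close>. So \<open>I\<close> is the full preimage of its image.\<close>

lemma (in ring_hom_ring) mem_img_iff:
  assumes "ideal I R" and "a_kernel R S h \<subseteq> I" and x: "x \<in> carrier R"
  shows "h x \<in> h ` I \<longleftrightarrow> x \<in> I"
proof
  interpret I: ideal I R by fact
  assume "h x \<in> h ` I"
  then obtain y where y: "y \<in> I" "h x = h y"
    by (rule imageE)
  have carr: "y \<in> carrier R"
    by (rule I.Icarr[OF y(1)])
  have "h (x \<oplus> \<ominus> y) = \<zero>\<^bsub>S\<^esub>"
    unfolding hom_add[OF x R.a_inv_closed[OF carr]] hom_a_inv[OF carr] y(2)
    by (rule S.r_neg[OF hom_closed[OF carr]])
  then have "x \<oplus> \<ominus> y \<in> a_kernel R S h"
    unfolding a_kernel_def' using x carr by blast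
  then have "(x \<oplus> \<ominus> y) \<oplus> y \<in> I"
    by (intro I.a_closed subsetD[OF assms(2)] y(1))
  also have "(x \<oplus> \<ominus> y) \<oplus> y = x"
    using x carr by (simp add: R.a_assoc R.l_neg)
  finally show "x \<in> I" .
qed simp

text \<open>Surjectivity lifts each multiplier from \<open>S\<close> to \<open>R\<close>, where
  \<open>I\<close> absorbs it.\<close>

lemma (in ring_hom_ring) img_is_ideal:
  assumes "ideal I R" and surj: "h ` carrier R = carrier S"
  shows "ideal (h ` I) S"
proof (rule idealI[OF S.ring_axioms])
  interpret I: ideal I R by fact
  show "subgroup (h ` I) (add_monoid S)"
    by (rule img_is_add_subgroup[OF I.a_subgroup])
  fix a x
  assume "a \<in> h ` I" "x \<in> carrier S"
  then obtain b y where b: "b \<in> I" "a = h b" and y: "y \<in> carrier R" "x = h y"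
    using surj by blast
  show "x \<otimes>\<^bsub>S\<^esub> a \<in> h ` I"
    unfolding b(2) y(2) hom_mult[OF y(1) I.Icarr[OF b(1)], symmetric]
    by (rule imageI[OF I.I_l_closed[OF b(1) y(1)]])
  show "a \<otimes>\<^bsub>S\<^esub> x \<in> h ` I"
    unfolding b(2) y(2) hom_mult[OF I.Icarr[OF b(1)] y(1), symmetric]
    by (rule imageI[OF I.I_r_closed[OF b(1) y(1)]])
qed

text \<open>An ideal product is generated by products of elements under addition, and
  \<open>h\<close> preserves both operations.\<close>

lemma (in ring_hom_ring) img_ideal_prod_vimage:
  assumes "z \<in> {x \<in> carrier R. h x \<in> I} \<cdot>\<^bsub>R\<^esub> {x \<in> carrier R. h x \<in> J}"
  shows "z \<in> carrier R \<and> h z \<in> I \<cdot>\<^bsub>S\<^esub> J"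
  using assms
  by (induction rule: ideal_prod.induct) (auto intro: ideal_prod.intros)

text \<open>Primeness is tested on preimages: their product maps into the image of \<open>P\<close>,
  so it lies in \<open>P\<close> because \<open>P\<close> contains the kernel. Surjectivity carries
  the resulting inclusion back to \<open>S\<close>.\<close>

lemma (in ring_hom_ring) img_is_two_sided_primeideal:
  assumes P: "two_sided_primeideal P R" and ker: "a_kernel R S h \<subseteq> P"
    and surj: "h ` carrier R = carrier S"
  shows "two_sided_primeideal (h ` P) S"
proof -
  interpret P: two_sided_primeideal P R by fact
  note mem = mem_img_iff[OF P.is_ideal ker]
  show ?thesis
  proof (intro two_sided_primeideal.intro two_sided_primeideal_axioms.intro)
    show "ideal (h ` P) S"
      by (rule img_is_ideal[OF P.is_ideal surj])
    show "carrier S \<noteq> h ` P"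
    proof
      assume "carrier S = h ` P"
      then have "carrier R \<subseteq> P"
        using mem hom_closed by auto
      then show False
        using P.P_notcarr P.a_subset by auto
    qed
  next
    fix I J
    assume I: "ideal I S" and J: "ideal J S" and IJ: "I \<cdot>\<^bsub>S\<^esub> J \<subseteq> h ` P"
    let ?pre = "\<lambda>I. {x \<in> carrier R. h x \<in> I}"
    have "?pre I \<cdot>\<^bsub>R\<^esub> ?pre J \<subseteq> P"
      using img_ideal_prod_vimage IJ mem by blast
    then have "?pre I \<subseteq> P \<or> ?pre J \<subseteq> P"
      by (intro P.P_prime ideal_vimage I J)
    moreover have "L \<subseteq> h ` P" if L: "ideal L S" "?pre L \<subseteq> P" for L
    proof
      fix y assume "y \<in> L"
      then obtain x where "x \<in> carrier R" "y = h x"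
        using surj ideal.Icarr[OF L(1)] by blast
      then show "y \<in> h ` P"
        using L(2) \<open>y \<in> L\<close> by auto
    qed
    ultimately show "I \<subseteq> h ` P \<or> J \<subseteq> h ` P"
      using I J by blast
  qed
qed

theorem theorem2p15:
  fixes R :: "('a, 'm) ring_scheme"
    and A :: "nat \<Rightarrow> ('b, 'n) ring_scheme"
    and n :: nat
  assumes "subdirect_product R n A"
    and "\<And>i. i \<in> {1..n} \<Longrightarrow> P_symmetric_ring (A i)"
  shows "P_symmetric_ring R"
proof -
  obtain f where R: "ring R"
    and hom: "\<And>i. i \<in> {1..n} \<Longrightarrow> f i \<in> ring_hom R (A i)"
    and surj: "\<And>i. i \<in> {1..n} \<Longrightarrow> f i ` carrier R = carrier (A i)"
    and ker: "carrier R \<inter> (\<Inter>i\<in>{1..n}. a_kernel R (A i) (f i)) = {\<zero>\<^bsub>R\<^esub>}"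
    using assms(1) unfolding subdirect_product_def by blast
  interpret R: ring R by fact
  have hom_ring: "ring_hom_ring R (A i) (f i)" if "i \<in> {1..n}" for i
    by (rule ring_hom_ringI2[OF R P_symmetric_ring.axioms(1)[OF assms(2)[OF that]] hom[OF that]])
  show ?thesis
  proof (intro P_symmetric_ring.intro P_symmetric_ring_axioms.intro R)
    fix a b c
    assume abc: "a \<in> carrier R" "b \<in> carrier R" "c \<in> carrier R"
      and zero: "a \<otimes>\<^bsub>R\<^esub> b \<otimes>\<^bsub>R\<^esub> c = \<zero>\<^bsub>R\<^esub>"
    have "b \<otimes>\<^bsub>R\<^esub> a \<otimes>\<^bsub>R\<^esub> c \<in> P" if P: "two_sided_primeideal P R" for P
    proof -
      interpret P: two_sided_primeideal P R by fact
      have "\<exists>i\<in>{1..n}. a_kernel R (A i) (f i) \<subseteq> P"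
      proof (rule P.finite_Inter_subset_imp)
        show "ideal (a_kernel R (A i) (f i)) R" if "i \<in> {1..n}" for i
          by (rule ring_hom_ring.kernel_is_ideal[OF hom_ring[OF that]])
        show "carrier R \<inter> (\<Inter>i\<in>{1..n}. a_kernel R (A i) (f i)) \<subseteq> P"
          unfolding ker using P.zero_closed by blast
      qed (rule finite_atLeastAtMost)
      then obtain i where i: "i \<in> {1..n}" and sub: "a_kernel R (A i) (f i) \<subseteq> P"
        by blast
      interpret h: ring_hom_ring R "A i" "f i"
        by (rule hom_ring[OF i])
      have "f i a \<otimes>\<^bsub>A i\<^esub> f i b \<otimes>\<^bsub>A i\<^esub> f i c = \<zero>\<^bsub>A i\<^esub>"
        using arg_cong[OF zero, of "f i"] abc by simp
      then have "f i (b \<otimes>\<^bsub>R\<^esub> a \<otimes>\<^bsub>R\<^esub> c) \<in> prime_radical (A i)"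
        using P_symmetric_ring.P_symmetric[OF assms(2)[OF i]] abc by simp
      then have "f i (b \<otimes>\<^bsub>R\<^esub> a \<otimes>\<^bsub>R\<^esub> c) \<in> f i ` P"
        using h.img_is_two_sided_primeideal[OF P sub surj[OF i]]
        unfolding prime_radical_def by blast
      then show ?thesis
        \<comment> \<open>Without \<open>h.hom_mult\<close> the image of the product stays unsplit
          and matches \<open>h.mem_img_iff\<close>.\<close>
        using h.mem_img_iff[OF P.is_ideal sub] abc by (simp del: h.hom_mult)
    qed
    then show "b \<otimes>\<^bsub>R\<^esub> a \<otimes>\<^bsub>R\<^esub> c \<in> prime_radical R"
      using abc unfolding prime_radical_def by simp
  qed
qed

end
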